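(* Let $G$ be an ordered abelian group, $n\in\mathbb{N}$, $B\subseteq G$, and let $f\colon G^n\to G$ be a function which is $L_{\mathrm{oag}}$-definable with parameters from $B$. Then there exists a partition of $G^n$ into finitely many $B$-definable sets such that on each such set $A$, $f$ is linear in the following sense: there exist $r_1,\dots,r_n,s\in\mathbb{Z}$ with $s\neq 0$ and $b\in\operatorname{dcl}(B)$ such that for every $\bar a=(a_1,\dots,a_n)\in A$ we have $f(a_1,\dots,a_n)=\frac1s\left(\sum_i r_ia_i+b\right)$.
   Context: $\mathbb{N}=\{1,2,3,\dots\}$. An ordered abelian group is an abelian group $(G,+)$ with a total order $<$ such that $a<b\iff a+c<b+c$ for all $a,b,c\in G$; it is torsion free. $L_{\mathrm{oag}}=\{0,+,<\}$. "$B$-definable" means $L_{\mathrm{oag}}$-definable in $G$ with parameters from $B$, and $\operatorname{dcl}(B)$ is the definable closure of $B$ in $G$ in the language $L_{\mathrm{oag}}$. The equation $f(\bar a)=\frac1s(\sum_i r_ia_i+b)$ means $s\cdot f(\bar a)=\sum_i r_ia_i+b$ in $G$. *)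

theory Defs
  imports "HOL-Library.Disjoint_Sets"
begin

datatype oag_term =
    Var nat
  | Zero
  | Plus oag_term oag_term

text \<open>The remaining connectives and the universal quantifier are expressible through these.
  Bound variables are named: \<open>Ex x \<phi>\<close> binds the variable with index \<open>x\<close> in \<open>\<phi>\<close>.\<close>

datatype oag_fm =
    Eq oag_term oag_term
  | Less oag_term oag_term
  | Neg oag_fm
  | Conj oag_fm oag_fm
  | Ex nat oag_fm

fun tvars :: "oag_term \<Rightarrow> nat set" where
  "tvars (Var i) = {i}"
| "tvars Zero = {}"
| "tvars (Plus s t) = tvars s \<union> tvars t"

fun fvars :: "oag_fm \<Rightarrow> nat set" where
  "fvars (Eq s t) = tvars s \<union> tvars t"
| "fvars (Less s t) = tvars s \<union> tvars t"
| "fvars (Neg \<phi>) = fvars \<phi>"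
| "fvars (Conj \<phi> \<psi>) = fvars \<phi> \<union> fvars \<psi>"
| "fvars (Ex x \<phi>) = fvars \<phi> - {x}"

fun tval :: "(nat \<Rightarrow> 'a::linordered_ab_group_add) \<Rightarrow> oag_term \<Rightarrow> 'a" where
  "tval e (Var i) = e i"
| "tval e Zero = 0"
| "tval e (Plus s t) = tval e s + tval e t"

fun sat :: "(nat \<Rightarrow> 'a::linordered_ab_group_add) \<Rightarrow> oag_fm \<Rightarrow> bool" where
  "sat e (Eq s t) \<longleftrightarrow> tval e s = tval e t"
| "sat e (Less s t) \<longleftrightarrow> tval e s < tval e t"
| "sat e (Neg \<phi>) \<longleftrightarrow> \<not> sat e \<phi>"
| "sat e (Conj \<phi> \<psi>) \<longleftrightarrow> sat e \<phi> \<and> sat e \<psi>"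
| "sat e (Ex x \<phi>) \<longleftrightarrow> (\<exists>a. sat (e(x := a)) \<phi>)"

lemma tval_cong: "(\<And>i. i \<in> tvars t \<Longrightarrow> e i = e' i) \<Longrightarrow> tval e t = tval e' t"
  by (induction t) auto

lemma sat_cong: "(\<And>i. i \<in> fvars \<phi> \<Longrightarrow> e i = e' i) \<Longrightarrow> sat e \<phi> \<longleftrightarrow> sat e' \<phi>"
proof (induction \<phi> arbitrary: e e')
  case (Eq s t)
  then show ?case using tval_cong[of s e e'] tval_cong[of t e e'] by simp
next
  case (Less s t)
  then show ?case using tval_cong[of s e e'] tval_cong[of t e e'] by simp
next
  case (Neg \<phi>)
  have "sat e \<phi> \<longleftrightarrow> sat e' \<phi>"
    by (rule Neg.IH) (simp add: Neg.prems)
  then show ?case by simp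
next
  case (Conj \<phi> \<psi>)
  have "sat e \<phi> \<longleftrightarrow> sat e' \<phi>"
    by (rule Conj.IH(1)) (simp add: Conj.prems)
  moreover have "sat e \<psi> \<longleftrightarrow> sat e' \<psi>"
    by (rule Conj.IH(2)) (simp add: Conj.prems)
  ultimately show ?case by simp
next
  case (Ex x \<phi>)
  have "sat (e(x := a)) \<phi> \<longleftrightarrow> sat (e'(x := a)) \<phi>" for a
    by (rule Ex.IH) (simp add: Ex.prems)
  then show ?case by simp
qed

text \<open>\<open>G\<close> is the type \<open>'a\<close>; \<open>G\<^sup>n\<close> is represented by the lists of length \<open>n\<close>.\<close>

definition tuples :: "nat \<Rightarrow> 'a list set" where
  "tuples n = {xs. length xs = n}"

text \<open>\<open>X \<subseteq> G\<^sup>n\<close> is \<open>{a \<in> G\<^sup>n. G \<Turnstile> \<phi>(a, b)}\<close> for a formula \<open>\<phi>\<close> and a finite tuple \<open>b\<close> from \<open>B\<close>.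
  The variables with indices below \<open>n\<close> stand for \<open>a\<close>, the next \<open>length b\<close> ones for \<open>b\<close>. The condition
  on the free variables ensures that the values of \<open>(!)\<close> beyond the end of the list are irrelevant.\<close>

definition definable :: "'a::linordered_ab_group_add set \<Rightarrow> nat \<Rightarrow> 'a list set \<Rightarrow> bool" where
  "definable B n X \<longleftrightarrow>
    (\<exists>\<phi> bs. set bs \<subseteq> B \<and> fvars \<phi> \<subseteq> {..<n + length bs} \<and>
       X = {as \<in> tuples n. sat (\<lambda>i. (as @ bs) ! i) \<phi>})"

text \<open>A function \<open>G\<^sup>n \<rightarrow> G\<close> is definable if its graph, a subset of \<open>G\<^sup>n\<^sup>+\<^sup>1\<close>, is. Only the values of
  \<open>f\<close> on lists of length \<open>n\<close> matter.\<close>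

definition definable_fun ::
    "'a::linordered_ab_group_add set \<Rightarrow> nat \<Rightarrow> ('a list \<Rightarrow> 'a) \<Rightarrow> bool" where
  "definable_fun B n f \<longleftrightarrow> definable B (Suc n) {as @ [f as] | as. as \<in> tuples n}"

definition dcl :: "'a::linordered_ab_group_add set \<Rightarrow> 'a set" where
  "dcl B = {b. definable B 1 {[b]}}"

definition int_scale :: "int \<Rightarrow> 'a::ab_group_add \<Rightarrow> 'a" where
  "int_scale k a = (if k \<ge> 0 then ((+) a ^^ nat k) 0 else - ((+) a ^^ nat (- k)) 0)"

text \<open>\<open>f(a) = 1/s (r\<^sub>1 a\<^sub>1 + \<dots> + r\<^sub>n a\<^sub>n + b)\<close> for all \<open>a \<in> A\<close>, with the denominator cleared;
  coordinates are numbered from \<open>0\<close>.\<close>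

definition linear_on ::
    "'a::linordered_ab_group_add set \<Rightarrow> nat \<Rightarrow> ('a list \<Rightarrow> 'a) \<Rightarrow> 'a list set \<Rightarrow> bool" where
  "linear_on B n f A \<longleftrightarrow>
    (\<exists>(r :: nat \<Rightarrow> int) (s :: int) b. s \<noteq> 0 \<and> b \<in> dcl B \<and>
       (\<forall>as \<in> A. int_scale s (f as) = (\<Sum>i<n. int_scale (r i) (as ! i)) + b))"

end

theory Submission
  imports Defs "HOL.Modules"
begin

text \<open>
  No quantifier elimination is needed. In a saturated group, if no nonzero multiple of \<open>c\<close> lies in the
  subgroup generated by the parameters (and the least positive element, if there is one), then some
  divisible \<open>d > 0\<close> is infinitely smaller than the distance of \<open>c\<close> from the \<open>\<rat>\<close>-span of that
  subgroup. With a linear functional \<open>\<mu>\<close> on the divisible hull that vanishes on this span and on the convex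
  hull of \<open>d\<close> but not at \<open>c\<close>, the map \<open>x \<mapsto> x + \<mu>(x) d\<close> is an automorphism that fixes the
  parameters and moves \<open>c\<close>, so \<open>c\<close> is not definable.

  A finitary version of this argument works in \<open>G\<close> itself: tuples \<open>e\<close> and \<open>e + t d\<close> satisfy the same
  formulas of bounded complexity when \<open>d\<close> is sufficiently divisible and small compared to all short
  integer combinations of \<open>e\<close> that the shift changes. Consequently the definition of \<open>f\<close> bounds the
  coefficients of a linear relation between \<open>f(a)\<close>, \<open>a\<close>, the parameters and the least positive element,
  and each of the finitely many relations holds on a definable set.
\<close>

section \<open>Integer multiples\<close>

lemma int_scale_add1: "int_scale (k + 1) (a :: 'a::ab_group_add) = int_scale k a + a"
proof (cases "k \<ge> 0")
  case True
  then have "nat (k + 1) = Suc (nat k)" by simp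
  with True show ?thesis by (simp add: int_scale_def add.commute)
next
  case False
  then have "nat (- k) = Suc (nat (- (k + 1)))" by simp
  with False show ?thesis by (auto simp: int_scale_def)
qed

lemma int_scale_0 [simp]: "int_scale 0 (a :: 'a::ab_group_add) = 0"
  by (simp add: int_scale_def)

lemma int_scale_add: "int_scale (k + l) (a :: 'a::ab_group_add) = int_scale k a + int_scale l a"
proof (induction l rule: int_induct[of _ 0])
  case (step1 i)
  then show ?case
    using int_scale_add1[of "k + i" a] int_scale_add1[of i a] by (simp add: algebra_simps)
next
  case (step2 i)
  then show ?case
    using int_scale_add1[of "k + (i - 1)" a] int_scale_add1[of "i - 1" a]
    by (simp add: algebra_simps)
qed simp

lemma int_scale_add_right:
  "int_scale k (a + b :: 'a::ab_group_add) = int_scale k a + int_scale k b"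
proof (induction k rule: int_induct[of _ 0])
  case (step1 i)
  then show ?case by (simp add: int_scale_add1)
next
  case (step2 i)
  then show ?case
    using int_scale_add1[of "i - 1" a] int_scale_add1[of "i - 1" b] int_scale_add1[of "i - 1" "a + b"]
    by (simp add: algebra_simps)
qed simp

lemma int_scale_1: "int_scale 1 (a :: 'a::ab_group_add) = a"
  using int_scale_add1[of 0 a] by simp

lemma int_scale_mult: "int_scale k (int_scale l (a :: 'a::ab_group_add)) = int_scale (k * l) a"
proof (induction k rule: int_induct[of _ 0])
  case (step1 i)
  then show ?case by (simp add: int_scale_add1 distrib_right int_scale_add int_scale_1)
next
  case (step2 i)
  then show ?case
    using int_scale_add1[of "i - 1" "int_scale l a"] int_scale_add[of "(i - 1) * l" l a]
    by (simp add: algebra_simps)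
qed simp

text \<open>Makes the module rules, in particular those for sums and signs of scalars, available for
  \<open>int_scale\<close>.\<close>

interpretation Z: module "int_scale :: int \<Rightarrow> 'a::ab_group_add \<Rightarrow> 'a"
  by unfold_locales (simp_all add: int_scale_add_right int_scale_add int_scale_mult int_scale_1)

section \<open>Order and size of integer multiples\<close>

lemma int_scale_pos:
  fixes a :: "'a::linordered_ab_group_add"
  assumes "0 < k" "0 < a"
  shows "0 < int_scale k a"
  using assms(1)
proof (induction k rule: int_gr_induct)
  case base
  then show ?case using assms(2) by simp
next
  case (step i)
  then show ?case using assms(2) by (simp add: int_scale_add1 add_pos_pos)
qed

lemma int_scale_nonneg:
  fixes a :: "'a::linordered_ab_group_add"
  assumes "0 \<le> k" "0 \<le> a"
  shows "0 \<le> int_scale k a"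
  using assms int_scale_pos[of k a] by (cases "k = 0 \<or> a = 0") (auto simp: less_imp_le)

lemma int_scale_mono:
  fixes a :: "'a::linordered_ab_group_add"
  assumes "k \<le> l" "0 \<le> a"
  shows "int_scale k a \<le> int_scale l a"
  using int_scale_nonneg[of "l - k" a] assms by (simp add: Z.scale_left_diff_distrib)

lemma int_scale_le_cancel:
  fixes a b :: "'a::linordered_ab_group_add"
  assumes "0 < k"
  shows "int_scale k a \<le> int_scale k b \<longleftrightarrow> a \<le> b"
proof
  assume "a \<le> b"
  then show "int_scale k a \<le> int_scale k b"
    using int_scale_nonneg[of k "b - a"] assms by (simp add: Z.scale_right_diff_distrib)
next
  assume le: "int_scale k a \<le> int_scale k b"
  show "a \<le> b"
  proof (rule ccontr)
    assume "\<not> a \<le> b"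
    then have "0 < int_scale k (a - b)" using int_scale_pos[of k "a - b"] assms by simp
    with le show False by (simp add: Z.scale_right_diff_distrib)
  qed
qed

text \<open>The class has no absolute value: \<open>near c x\<close> stands for \<open>\<bar>x\<bar> \<le> c\<close>.\<close>

definition near :: "'a::linordered_ab_group_add \<Rightarrow> 'a \<Rightarrow> bool" where
  "near c x \<longleftrightarrow> - c \<le> x \<and> x \<le> c"

lemma near_nonneg: "near c x \<Longrightarrow> 0 \<le> c"
  unfolding near_def by (meson neg_0_le_iff_le order.trans linear)

lemma near_mono: "near c x \<Longrightarrow> c \<le> c' \<Longrightarrow> near c' x"
  unfolding near_def by (meson neg_le_iff_le order.trans)

lemma near_minus [simp]: "near c (- x) \<longleftrightarrow> near c x"
  unfolding near_def by (metis minus_le_iff neg_le_iff_le)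

lemma near_add: "near c x \<Longrightarrow> near c' y \<Longrightarrow> near (c + c') (x + y)"
  unfolding near_def using add_mono[of "- c" x "- c'" y] add_mono[of x c y c']
  by (simp add: add.commute)

lemma near_diff: "near c x \<Longrightarrow> near c' y \<Longrightarrow> near (c + c') (x - y)"
  using near_add[of c x c' "- y"] by simp

lemma near_scale_cancel: "0 < k \<Longrightarrow> near (int_scale k c) (int_scale k x) \<longleftrightarrow> near c x"
  unfolding near_def using int_scale_le_cancel[of k "- c" x] int_scale_le_cancel[of k x c] by simp

lemma near_scale:
  assumes "near c x" "\<bar>k\<bar> \<le> K"
  shows "near (int_scale K c) (int_scale k x)"
proof -
  have "near (int_scale \<bar>k\<bar> c) (int_scale \<bar>k\<bar> x)"
    using near_scale_cancel[of "\<bar>k\<bar>" c x] assms(1) by (cases "k = 0") (auto simp: near_def)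
  then have "near (int_scale \<bar>k\<bar> c) (int_scale k x)"
    by (cases "k \<ge> 0") auto
  then show ?thesis
    using near_mono int_scale_mono[OF assms(2) near_nonneg[OF assms(1)]] by blast
qed

lemma near_scale_self: "0 \<le> d \<Longrightarrow> \<bar>k\<bar> \<le> K \<Longrightarrow> near (int_scale K d) (int_scale k d)"
  using near_scale[of d d k K] by (simp add: near_def order.trans[of "- d" 0 d])

text \<open>An element outside the interval from \<open>- c\<close> to \<open>c\<close> dominates
  any perturbation inside it. This is what preserves atomic formulas under shifts.\<close>

lemma same_sign_if_not_near:
  fixes x y :: "'a::linordered_ab_group_add"
  assumes "\<not> near c x" "near c y"
  shows "x + y = 0 \<longleftrightarrow> x = 0" "x + y < 0 \<longleftrightarrow> x < 0"
proof -
  have c: "0 \<le> c" using assms(2) by (rule near_nonneg)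
  have y: "- c \<le> y" "y \<le> c" using assms(2) by (auto simp: near_def)
  consider "c < x" | "x < - c" using assms(1) by (auto simp: near_def not_le)
  then have "(0 < x + y \<and> 0 < x) \<or> (x + y < 0 \<and> x < 0)"
  proof cases
    case 1
    then have "c + - c < x + y" using y(1) by (rule add_less_le_mono)
    then show ?thesis using 1 c by auto
  next
    case 2
    then have "x + y < - c + c" using y(2) by (rule add_less_le_mono)
    then show ?thesis using 2 c by (auto intro: less_le_trans)
  qed
  then show "x + y = 0 \<longleftrightarrow> x = 0" "x + y < 0 \<longleftrightarrow> x < 0" by auto
qed

section \<open>Invariance of formulas under small shifts\<close>

text \<open>Combinations with \<open>(\<Sum>i\<in>F. r i * t i) = 0\<close> keep their value under
  the shift. The others lie so far from 0, on the scale of \<open>d\<close>, that for large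
  \<open>Q\<close> the shift cannot change their sign. Divisibility of \<open>d\<close> allows
  passing to a fraction of it when a quantifier brings in a new variable.\<close>

definition good_shift ::
    "nat set \<Rightarrow> nat \<Rightarrow> int \<Rightarrow> int \<Rightarrow> (nat \<Rightarrow> 'a::linordered_ab_group_add) \<Rightarrow> (nat \<Rightarrow> int) \<Rightarrow> 'a \<Rightarrow> bool"
  where
  "good_shift F M Q T e t d \<longleftrightarrow>
    0 < d \<and> (\<exists>\<delta>. d = int_scale (fact M) \<delta>) \<and> (\<forall>i\<in>F. \<bar>t i\<bar> \<le> T) \<and>
    (\<forall>r. (\<forall>i\<in>F. \<bar>r i\<bar> \<le> int M) \<and> (\<Sum>i\<in>F. r i * t i) \<noteq> 0 \<longrightarrow>
       \<not> near (int_scale Q d) (\<Sum>i\<in>F. int_scale (r i) (e i)))"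

abbreviation shift ::
    "(nat \<Rightarrow> 'a::linordered_ab_group_add) \<Rightarrow> (nat \<Rightarrow> int) \<Rightarrow> 'a \<Rightarrow> nat \<Rightarrow> 'a" where
  "shift e t d \<equiv> \<lambda>i. e i + int_scale (t i) d"

lemma fact_dvd_scale:
  assumes "m \<le> n" and "d = int_scale (fact n) \<delta>"
  shows "\<exists>\<delta>'. d = int_scale (fact m) \<delta>'"
proof -
  have "(fact m :: int) dvd fact n" using assms(1) by (rule fact_dvd)
  then obtain c where "(fact n :: int) = fact m * c" ..
  then show ?thesis using assms(2) by (metis int_scale_mult)
qed

lemma good_shift_mono:
  assumes gs: "good_shift F M Q T e t d"
    and "finite F" "F' \<subseteq> F" "M' \<le> M" "Q' \<le> Q"
  shows "good_shift F' M' Q' T e t d"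
proof -
  have d: "0 < d" and div: "\<exists>\<delta>. d = int_scale (fact M) \<delta>" and t: "\<forall>i\<in>F. \<bar>t i\<bar> \<le> T"
    and far: "\<And>r. (\<forall>i\<in>F. \<bar>r i\<bar> \<le> int M) \<Longrightarrow> (\<Sum>i\<in>F. r i * t i) \<noteq> 0 \<Longrightarrow>
       \<not> near (int_scale Q d) (\<Sum>i\<in>F. int_scale (r i) (e i))"
    using gs unfolding good_shift_def by blast+
  have "\<not> near (int_scale Q' d) (\<Sum>i\<in>F'. int_scale (r i) (e i))"
    if r: "\<forall>i\<in>F'. \<bar>r i\<bar> \<le> int M'" and nz: "(\<Sum>i\<in>F'. r i * t i) \<noteq> 0" for r
  proof -
    \<comment> \<open>Zero coefficients outside \<open>F'\<close> turn a combination over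
      \<open>F'\<close> into one over \<open>F\<close>.\<close>
    define r' where "r' i = (if i \<in> F' then r i else 0)" for i
    have "(\<Sum>i\<in>F. r' i * t i) = (\<Sum>i\<in>F'. r i * t i)"
      using assms(2,3) by (intro sum.mono_neutral_cong_right) (auto simp: r'_def)
    moreover have "(\<Sum>i\<in>F. int_scale (r' i) (e i)) = (\<Sum>i\<in>F'. int_scale (r i) (e i))"
      using assms(2,3) by (intro sum.mono_neutral_cong_right) (auto simp: r'_def)
    moreover have "\<forall>i\<in>F. \<bar>r' i\<bar> \<le> int M"
      using r assms(4) by (force simp: r'_def)
    ultimately have "\<not> near (int_scale Q d) (\<Sum>i\<in>F'. int_scale (r i) (e i))"
      using far[of r'] nz by simp
    moreover have "int_scale Q' d \<le> int_scale Q d"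
      using int_scale_mono[OF assms(5), of d] d by (simp add: less_imp_le)
    ultimately show ?thesis using near_mono by blast
  qed
  then show ?thesis
    unfolding good_shift_def using d div t fact_dvd_scale[OF assms(4)] assms(3) by blast
qed

lemma abs_sum_mult_le:
  fixes r t :: "nat \<Rightarrow> int"
  assumes "\<forall>i\<in>F. \<bar>r i\<bar> \<le> M" "\<forall>i\<in>F. \<bar>t i\<bar> \<le> T"
  shows "\<bar>\<Sum>i\<in>F. r i * t i\<bar> \<le> int (card F) * (M * T)"
proof -
  have "\<bar>r i * t i\<bar> \<le> M * T" if "i \<in> F" for i
    unfolding abs_mult using that assms by (intro mult_mono) force+
  then have "(\<Sum>i\<in>F. \<bar>r i * t i\<bar>) \<le> int (card F) * (M * T)"
    using sum_bounded_above[of F "\<lambda>i. \<bar>r i * t i\<bar>" "M * T"] by simp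
  then show ?thesis
    by (rule order.trans[OF sum_abs])
qed

lemma sum_scale_shift:
  "(\<Sum>i\<in>F. int_scale (r i) (shift e t d i)) =
     (\<Sum>i\<in>F. int_scale (r i) (e i)) + int_scale (\<Sum>i\<in>F. r i * t i) d"
  by (simp add: Z.scale_right_distrib sum.distrib Z.scale_sum_left)

text \<open>The shift displaces a combination by at most \<open>card F * M * T\<close> copies of
  \<open>d\<close>, so a gap widened by this amount still leaves \<open>Q\<close> copies afterwards.
  Needed for the converse direction of the quantifier step.\<close>

lemma good_shift_sym:
  assumes gs: "good_shift F M (Q + int (card F) * (int M * T)) T e t d"
  shows "good_shift F M Q T (shift e t d) (\<lambda>i. - t i) d"
proof -
  let ?C = "int (card F) * (int M * T)"
  have d: "0 < d" and div: "\<exists>\<delta>. d = int_scale (fact M) \<delta>" and t: "\<forall>i\<in>F. \<bar>t i\<bar> \<le> T"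
    and far: "\<And>r. (\<forall>i\<in>F. \<bar>r i\<bar> \<le> int M) \<Longrightarrow> (\<Sum>i\<in>F. r i * t i) \<noteq> 0 \<Longrightarrow>
       \<not> near (int_scale (Q + ?C) d) (\<Sum>i\<in>F. int_scale (r i) (e i))"
    using gs unfolding good_shift_def by blast+
  have "\<not> near (int_scale Q d) (\<Sum>i\<in>F. int_scale (r i) (shift e t d i))"
    if r: "\<forall>i\<in>F. \<bar>r i\<bar> \<le> int M" and nz: "(\<Sum>i\<in>F. r i * - t i) \<noteq> 0" for r
  proof
    assume "near (int_scale Q d) (\<Sum>i\<in>F. int_scale (r i) (shift e t d i))"
    moreover have "near (int_scale ?C d) (int_scale (\<Sum>i\<in>F. r i * t i) d)"
      using abs_sum_mult_le[OF r t] d by (intro near_scale_self) auto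
    ultimately have
      "near (int_scale Q d + int_scale ?C d) (\<Sum>i\<in>F. int_scale (r i) (e i))"
      unfolding sum_scale_shift by (metis near_diff add_diff_cancel_right')
    then show False
      using far[OF r] nz by (simp add: Z.scale_left_distrib sum_negf)
  qed
  then show ?thesis
    unfolding good_shift_def using d div t by auto
qed

text \<open>If some small combination involves \<open>y\<close>, it dictates how \<open>y\<close> has to be shifted (after passing
  to a fraction of \<open>d\<close>); two such combinations agree on this, since eliminating \<open>y\<close> from them gives
  a small combination of the old values. Otherwise \<open>y\<close> need not be shifted.\<close>

lemma good_shift_extend:
  assumes gs: "good_shift F (2 * M * M) ((int M + 1) * Q) T e t d"
    and fin: "finite F" and x: "x \<notin> F" and M: "0 < M" and Q: "0 \<le> Q"
  shows "\<exists>t' d'. good_shift (insert x F) M Q (int M * \<bar>T\<bar> * (int (card F) + 1)) (e(x := y)) t' d' \<and>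
           (\<forall>i\<in>F. int_scale (t' i) d' = int_scale (t i) d)"
proof -
  let ?T = "int M * \<bar>T\<bar> * (int (card F) + 1)"
  have d: "0 < d" and div: "\<exists>\<delta>. d = int_scale (fact (2 * M * M)) \<delta>" and t: "\<forall>i\<in>F. \<bar>t i\<bar> \<le> T"
    and far: "\<And>r. (\<forall>i\<in>F. \<bar>r i\<bar> \<le> int (2 * M * M)) \<Longrightarrow> (\<Sum>i\<in>F. r i * t i) \<noteq> 0 \<Longrightarrow>
       \<not> near (int_scale ((int M + 1) * Q) d) (\<Sum>i\<in>F. int_scale (r i) (e i))"
    using gs unfolding good_shift_def by blast+
  have sum_ins: "(\<Sum>i\<in>insert x F. int_scale (r i) ((e(x := y)) i)) =
      int_scale (r x) y + (\<Sum>i\<in>F. int_scale (r i) (e i))" for r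
    using fin x by (simp add: sum.insert) (intro sum.cong, auto)
  \<comment> \<open>The absolute value is there because \<open>T\<close> may be negative when
    \<open>F\<close> is empty.\<close>
  have t': "\<forall>i\<in>F. \<bar>t i\<bar> \<le> \<bar>T\<bar>" using t by force
  have Tbig: "int M * \<bar>T\<bar> \<le> ?T" "int (card F) * (int M * \<bar>T\<bar>) \<le> ?T"
    by (simp_all add: algebra_simps)
  have M2: "M \<le> 2 * M * M" using M by simp
  show ?thesis
  \<comment> \<open>Negating a combination makes a nonzero coefficient of \<open>y\<close> positive,
    so it suffices to test \<open>s > 0\<close>.\<close>
  proof (cases "\<exists>s r. 0 < s \<and> s \<le> int M \<and> (\<forall>i\<in>F. \<bar>r i\<bar> \<le> int M) \<and>
      near (int_scale Q d) (int_scale s y + (\<Sum>i\<in>F. int_scale (r i) (e i)))")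
    case True
    then obtain s0 r0 where s0: "0 < s0" "s0 \<le> int M" and r0: "\<forall>i\<in>F. \<bar>r0 i\<bar> \<le> int M"
      and small: "near (int_scale Q d) (int_scale s0 y + (\<Sum>i\<in>F. int_scale (r0 i) (e i)))"
      by blast
    \<comment> \<open>The factorial of \<open>2 * M * M\<close> leaves room to divide
      \<open>d\<close> by \<open>s0\<close> and keep a quotient divisible by
      \<open>fact M\<close>.\<close>
    have "nat s0 dvd fact M" using s0 by (intro dvd_fact) auto
    then have "int (nat s0) dvd int (fact M)" by (simp only: int_dvd_int_iff)
    then have "s0 dvd fact M" using s0 by simp
    then have "fact M * s0 dvd (fact M * fact M :: int)" by (rule mult_dvd_mono[OF dvd_refl])
    also have "\<dots> dvd fact (2 * M)"
      using fact_fact_dvd_fact[of M M, where 'a = int] by (simp add: mult_2)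
    also have "\<dots> dvd fact (2 * M * M)"
      using M by (intro fact_dvd) simp
    finally obtain c where c: "(fact (2 * M * M) :: int) = fact M * s0 * c" ..
    obtain \<delta> where \<delta>: "d = int_scale (fact (2 * M * M)) \<delta>" using div by blast
    define d' where "d' = int_scale (fact M) (int_scale c \<delta>)"
    have dd': "d = int_scale s0 d'" unfolding d'_def \<delta> c by (simp add: int_scale_mult mult_ac)
    have d': "0 < d'"
      using d s0 int_scale_le_cancel[of s0 d' 0] unfolding dd' by (metis Z.scale_zero_right not_le)
    \<comment> \<open>The value at \<open>x\<close> makes the displacement of the combination given
      by \<open>s0\<close> and \<open>r0\<close> vanish; the factor \<open>s0\<close> elsewhere
      compensates for \<open>d = int_scale s0 d'\<close>.\<close>
    define t' where "t' i = (if i = x then - (\<Sum>j\<in>F. r0 j * t j) else s0 * t i)" for i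
    have t'F: "t' i = s0 * t i" if "i \<in> F" for i using that x by (auto simp: t'_def)
    have bound: "\<bar>t' i\<bar> \<le> ?T" if "i \<in> insert x F" for i
    proof (cases "i = x")
      case True
      then show ?thesis
        using abs_sum_mult_le[OF r0 t'] Tbig(2) by (simp add: t'_def)
    next
      case False
      then have "\<bar>t' i\<bar> = s0 * \<bar>t i\<bar>" using s0 that by (simp add: t'_def abs_mult)
      also have "\<dots> \<le> int M * \<bar>T\<bar>" using s0 t' False that by (intro mult_mono) auto
      finally show ?thesis using Tbig(1) by simp
    qed
    have "\<not> near (int_scale Q d') (\<Sum>i\<in>insert x F. int_scale (r i) ((e(x := y)) i))"
      if r: "\<forall>i\<in>insert x F. \<bar>r i\<bar> \<le> int M" and nz: "(\<Sum>i\<in>insert x F. r i * t' i) \<noteq> 0" for r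
    proof
      let ?z = "\<Sum>i\<in>F. int_scale (r i) (e i)" and ?w = "\<Sum>i\<in>F. int_scale (r0 i) (e i)"
      assume "near (int_scale Q d') (\<Sum>i\<in>insert x F. int_scale (r i) ((e(x := y)) i))"
      then have "near (int_scale s0 (int_scale Q d')) (int_scale s0 (int_scale (r x) y + ?z))"
        unfolding sum_ins near_scale_cancel[OF s0(1)] .
      then have n1: "near (int_scale Q d) (int_scale s0 (int_scale (r x) y + ?z))"
        by (simp only: dd' int_scale_mult mult.commute)
      have n2: "near (int_scale (int M) (int_scale Q d)) (int_scale (r x) (int_scale s0 y + ?w))"
        using r by (intro near_scale small) auto
      \<comment> \<open>Eliminating \<open>y\<close> gives a combination over \<open>F\<close> with
        coefficients up to \<open>2 * M * M\<close> and size up to \<open>(M + 1) * Q\<close> copies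
        of \<open>d\<close>. Its displacement under \<open>t\<close> is that of \<open>r\<close>
        under \<open>t'\<close>, hence nonzero, against the gap assumed over
        \<open>F\<close>.\<close>
      let ?q = "\<lambda>i. s0 * r i - r x * r0 i"
      have diff: "int_scale s0 (int_scale (r x) y + ?z) - int_scale (r x) (int_scale s0 y + ?w)
          = (\<Sum>i\<in>F. int_scale (?q i) (e i))"
        by (simp add: Z.scale_right_distrib Z.scale_sum_right Z.scale_left_diff_distrib
            sum_subtractf mult.commute[of "r x" s0])
      have "int_scale Q d + int_scale (int M) (int_scale Q d) = int_scale ((int M + 1) * Q) d"
        by (simp add: distrib_right Z.scale_left_distrib add.commute)
      then have "near (int_scale ((int M + 1) * Q) d) (\<Sum>i\<in>F. int_scale (?q i) (e i))"
        using near_diff[OF n1 n2] unfolding diff by metis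
      moreover have "\<forall>i\<in>F. \<bar>?q i\<bar> \<le> int (2 * M * M)"
      proof
        fix i assume i: "i \<in> F"
        have "\<bar>s0 * r i\<bar> \<le> int M * int M" "\<bar>r x * r0 i\<bar> \<le> int M * int M"
          unfolding abs_mult using s0 r r0 i by (auto intro!: mult_mono)
        then show "\<bar>?q i\<bar> \<le> int (2 * M * M)" by simp
      qed
      moreover have "(\<Sum>i\<in>F. ?q i * t i) = (\<Sum>i\<in>insert x F. r i * t' i)"
      proof -
        have "(\<Sum>i\<in>insert x F. r i * t' i) = r x * t' x + (\<Sum>i\<in>F. r i * (s0 * t i))"
          using fin x by (simp add: t'F)
        also have "r x * t' x = - (\<Sum>i\<in>F. r x * r0 i * t i)"
          by (simp add: t'_def sum_distrib_left mult.assoc)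
        finally show ?thesis
          by (simp add: algebra_simps sum_subtractf)
      qed
      ultimately show False using far[of ?q] nz by simp
    qed
    then have "good_shift (insert x F) M Q ?T (e(x := y)) t' d'"
      unfolding good_shift_def using d' bound d'_def by blast
    moreover have "\<forall>i\<in>F. int_scale (t' i) d' = int_scale (t i) d"
      unfolding dd' by (simp add: t'F mult.commute)
    ultimately show ?thesis by blast
  next
    case False
    then have large: "\<not> near (int_scale Q d) (int_scale s y + (\<Sum>i\<in>F. int_scale (r i) (e i)))"
      if "0 < s" "s \<le> int M" "\<forall>i\<in>F. \<bar>r i\<bar> \<le> int M" for s r
      using that by blast
    define t' where "t' = t(x := 0)"
    have t'F: "t' i = t i" if "i \<in> F" for i using that x by (auto simp: t'_def)
    have bound: "\<bar>t' i\<bar> \<le> ?T" if "i \<in> insert x F" for i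
    proof (cases "i = x")
      case False
      then have "\<bar>t i\<bar> \<le> \<bar>T\<bar>" using that t' by auto
      also have "\<dots> \<le> int M * \<bar>T\<bar>" using M mult_right_mono[of 1 "int M" "\<bar>T\<bar>"] by simp
      finally show ?thesis using Tbig(1) False by (simp add: t'_def)
    qed (simp add: t'_def)
    have "\<not> near (int_scale Q d) (\<Sum>i\<in>insert x F. int_scale (r i) ((e(x := y)) i))"
      if r: "\<forall>i\<in>insert x F. \<bar>r i\<bar> \<le> int M" and nz: "(\<Sum>i\<in>insert x F. r i * t' i) \<noteq> 0" for r
    proof -
      let ?z = "\<lambda>r. \<Sum>i\<in>F. int_scale (r i) (e i)"
      consider "r x = 0" | "0 < r x" | "r x < 0" by linarith
      then have "\<not> near (int_scale Q d) (int_scale (r x) y + ?z r)"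
      proof cases
        case 1
        \<comment> \<open>The combination involves only \<open>F\<close>, where the given shift is
          already good.\<close>
        have "good_shift F M Q T e t d"
        proof (rule good_shift_mono[OF gs fin order.refl M2])
          show "Q \<le> (int M + 1) * Q" using Q by (simp add: distrib_right)
        qed
        moreover have "(\<Sum>i\<in>F. r i * t i) \<noteq> 0"
          using nz fin x by (simp add: t'F t'_def[THEN fun_cong, of x, simplified])
        ultimately show ?thesis using r 1 by (auto simp: good_shift_def)
      next
        case 2
        then show ?thesis using r by (intro large) auto
      next
        case 3
        have "\<not> near (int_scale Q d) (int_scale (- r x) y + ?z (\<lambda>i. - r i))"
          using r 3 by (intro large) auto
        moreover have "int_scale (- r x) y + ?z (\<lambda>i. - r i) = - (int_scale (r x) y + ?z r)"
          by (simp add: sum_negf)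
        ultimately show ?thesis by (metis near_minus)
      qed
      then show ?thesis unfolding sum_ins .
    qed
    then have "good_shift (insert x F) M Q ?T (e(x := y)) t' d"
      unfolding good_shift_def using d bound div fact_dvd_scale[OF M2] by blast
    then show ?thesis using t'F by (intro exI[of _ t'] exI[of _ d]) simp
  qed
qed

section \<open>Terms as integer combinations, and invariance of formulas\<close>

fun mult_of :: "oag_term \<Rightarrow> nat \<Rightarrow> int" where
  "mult_of (Var j) i = (if i = j then 1 else 0)"
| "mult_of Zero i = 0"
| "mult_of (Plus s t) i = mult_of s i + mult_of t i"

lemma tval_eq_sum:
  assumes "finite F" "tvars u \<subseteq> F"
  shows "tval e u = (\<Sum>i\<in>F. int_scale (mult_of u i) (e i))"
  using assms(2)
proof (induction u)
  case (Var j)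
  have "(\<Sum>i\<in>F. int_scale (mult_of (Var j) i) (e i)) = (\<Sum>i\<in>F. if i = j then e i else 0)"
    by (rule sum.cong) auto
  then show ?case using assms(1) Var by simp
qed (auto simp: Z.scale_left_distrib sum.distrib)

lemma finite_tvars: "finite (tvars u)"
  by (induction u) auto

lemma finite_fvars: "finite (fvars \<phi>)"
  by (induction \<phi>) (auto simp: finite_tvars)

text \<open>The difference of the two sides is a fixed integer combination, to which the shift adds
  some number of copies of \<open>d\<close>. If that number is 0, nothing changes; otherwise
  goodness puts the old value beyond the size of the change.\<close>

lemma atom_invariant:
  fixes u v :: oag_term
  defines "F \<equiv> tvars u \<union> tvars v"
  shows "\<exists>M. \<forall>T. \<exists>Q. \<forall>(e :: nat \<Rightarrow> 'a::linordered_ab_group_add) t d. good_shift F M Q T e t d \<longrightarrow>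
    (tval e u = tval e v \<longleftrightarrow> tval (shift e t d) u = tval (shift e t d) v) \<and>
    (tval e u < tval e v \<longleftrightarrow> tval (shift e t d) u < tval (shift e t d) v)"
proof -
  have fin: "finite F" unfolding F_def by (simp add: finite_tvars)
  have uv: "tvars u \<subseteq> F" "tvars v \<subseteq> F" by (auto simp: F_def)
  define r where "r i = mult_of u i - mult_of v i" for i
  define M where "M = nat (\<Sum>i\<in>F. \<bar>r i\<bar>)"
  have "\<bar>r i\<bar> \<le> (\<Sum>i\<in>F. \<bar>r i\<bar>)" if "i \<in> F" for i
    using that fin by (intro member_le_sum) auto
  then have r: "\<forall>i\<in>F. \<bar>r i\<bar> \<le> int M" by (simp add: M_def sum_nonneg)
  have val: "tval e u - tval e v = (\<Sum>i\<in>F. int_scale (r i) (e i))" for e :: "nat \<Rightarrow> 'a"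
    using tval_eq_sum[OF fin, of u e] tval_eq_sum[OF fin, of v e] uv
    by (simp add: r_def Z.scale_left_diff_distrib sum_subtractf)
  have "(tval e u = tval e v \<longleftrightarrow> tval (shift e t d) u = tval (shift e t d) v) \<and>
    (tval e u < tval e v \<longleftrightarrow> tval (shift e t d) u < tval (shift e t d) v)"
    if gs: "good_shift F M (int (card F) * (int M * T)) T e t d" for T t and e :: "nat \<Rightarrow> 'a" and d
  proof -
    let ?x = "\<Sum>i\<in>F. int_scale (r i) (e i)" and ?k = "\<Sum>i\<in>F. r i * t i"
    let ?c = "int_scale (int (card F) * (int M * T)) d"
    have "(?x + int_scale ?k d = 0 \<longleftrightarrow> ?x = 0) \<and> (?x + int_scale ?k d < 0 \<longleftrightarrow> ?x < 0)"
    proof (cases "?k = 0")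
      case False
      with gs r have far: "\<not> near ?c ?x" unfolding good_shift_def by simp
      have "0 < d" "\<forall>i\<in>F. \<bar>t i\<bar> \<le> T" using gs unfolding good_shift_def by simp_all
      then have "near ?c (int_scale ?k d)"
        by (intro near_scale_self abs_sum_mult_le[OF r]) auto
      then show ?thesis using same_sign_if_not_near[OF far] by simp
    qed simp
    moreover have val': "?x + int_scale ?k d = tval (shift e t d) u - tval (shift e t d) v"
      unfolding val by (rule sum_scale_shift[symmetric])
    ultimately show ?thesis
      unfolding val' unfolding val[symmetric] by simp
  qed
  then show ?thesis by blast
qed

text \<open>The existential case is a back-and-forth step. It enlarges the bound on \<open>t\<close>
  by a factor depending on \<open>M\<close>, so \<open>M\<close> has to be fixed before
  \<open>T\<close>, whereas \<open>Q\<close> may depend on \<open>T\<close>.\<close>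

lemma sat_shift_invariant:
  "\<exists>M. \<forall>T. \<exists>Q. \<forall>(e :: nat \<Rightarrow> 'a::linordered_ab_group_add) t d.
    good_shift (fvars \<phi>) M Q T e t d \<longrightarrow> (sat e \<phi> \<longleftrightarrow> sat (shift e t d) \<phi>)"
proof (induction \<phi>)
  case (Eq u v)
  from atom_invariant[of u v] show ?case by (elim ex_forward all_forward) auto
next
  case (Less u v)
  from atom_invariant[of u v] show ?case by (elim ex_forward all_forward) auto
next
  case (Neg \<phi>)
  then show ?case by simp
next
  case (Conj \<phi> \<psi>)
  obtain M1 where M1: "\<forall>T. \<exists>Q. \<forall>(e :: nat \<Rightarrow> 'a) t d.
      good_shift (fvars \<phi>) M1 Q T e t d \<longrightarrow> (sat e \<phi> \<longleftrightarrow> sat (shift e t d) \<phi>)"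
    using Conj.IH(1) by blast
  obtain M2 where M2: "\<forall>T. \<exists>Q. \<forall>(e :: nat \<Rightarrow> 'a) t d.
      good_shift (fvars \<psi>) M2 Q T e t d \<longrightarrow> (sat e \<psi> \<longleftrightarrow> sat (shift e t d) \<psi>)"
    using Conj.IH(2) by blast
  show ?case
  proof (intro exI[of _ "max M1 M2"] allI)
    fix T
    obtain Q1 where Q1: "\<forall>(e :: nat \<Rightarrow> 'a) t d.
      good_shift (fvars \<phi>) M1 Q1 T e t d \<longrightarrow> (sat e \<phi> \<longleftrightarrow> sat (shift e t d) \<phi>)" using M1 by blast
    obtain Q2 where Q2: "\<forall>(e :: nat \<Rightarrow> 'a) t d.
      good_shift (fvars \<psi>) M2 Q2 T e t d \<longrightarrow> (sat e \<psi> \<longleftrightarrow> sat (shift e t d) \<psi>)" using M2 by blast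
    show "\<exists>Q. \<forall>(e :: nat \<Rightarrow> 'a) t d. good_shift (fvars (Conj \<phi> \<psi>)) (max M1 M2) Q T e t d \<longrightarrow>
        (sat e (Conj \<phi> \<psi>) \<longleftrightarrow> sat (shift e t d) (Conj \<phi> \<psi>))"
    proof (intro exI[of _ "max Q1 Q2"] allI impI)
      fix e :: "nat \<Rightarrow> 'a" and t d
      assume gs: "good_shift (fvars (Conj \<phi> \<psi>)) (max M1 M2) (max Q1 Q2) T e t d"
      have "good_shift (fvars \<phi>) M1 Q1 T e t d" "good_shift (fvars \<psi>) M2 Q2 T e t d"
        using good_shift_mono[OF gs finite_fvars] by auto
      then show "sat e (Conj \<phi> \<psi>) \<longleftrightarrow> sat (shift e t d) (Conj \<phi> \<psi>)"
        using Q1 Q2 by simp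
    qed
  qed
next
  case (Ex x \<phi>)
  let ?F = "fvars (Ex x \<phi>)"
  obtain M0 where M0: "\<forall>T. \<exists>Q. \<forall>(e :: nat \<Rightarrow> 'a) t d.
      good_shift (fvars \<phi>) M0 Q T e t d \<longrightarrow> (sat e \<phi> \<longleftrightarrow> sat (shift e t d) \<phi>)"
    using Ex.IH by blast
  \<comment> \<open>The successor makes \<open>M\<close> positive, as extending a shift
    requires.\<close>
  define M where "M = Suc M0"
  let ?M = "2 * M * M"
  show ?case
  proof (intro exI[of _ ?M] allI)
    fix T
    let ?T = "int M * \<bar>T\<bar> * (int (card ?F) + 1)"
    obtain Q0 where Q0: "\<forall>(e :: nat \<Rightarrow> 'a) t d.
        good_shift (fvars \<phi>) M0 Q0 ?T e t d \<longrightarrow> (sat e \<phi> \<longleftrightarrow> sat (shift e t d) \<phi>)"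
      using M0 by blast
    define Q where "Q = (int M + 1) * \<bar>Q0\<bar>"
    have forth: "sat (shift e t d) (Ex x \<phi>)"
      if gs: "good_shift ?F ?M Q T e t d" and "sat e (Ex x \<phi>)" for e :: "nat \<Rightarrow> 'a" and t d
    proof -
      obtain y where y: "sat (e(x := y)) \<phi>" using \<open>sat e (Ex x \<phi>)\<close> by auto
      obtain t' d' where gs': "good_shift (insert x ?F) M \<bar>Q0\<bar> ?T (e(x := y)) t' d'"
        and same: "\<forall>i\<in>?F. int_scale (t' i) d' = int_scale (t i) d"
        using good_shift_extend[OF gs[unfolded Q_def] finite_fvars, of x y] by (auto simp: M_def)
      have "good_shift (fvars \<phi>) M0 Q0 ?T (e(x := y)) t' d'"
        by (rule good_shift_mono[OF gs']) (auto simp: finite_fvars M_def)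
      then have "sat (shift (e(x := y)) t' d') \<phi>" using Q0 y by blast
      \<comment> \<open>By \<open>same\<close>, the two assignments agree on the free variables of
        \<open>\<phi>\<close>, so the shifted \<open>y\<close> is a witness.\<close>
      also have "sat (shift (e(x := y)) t' d') \<phi> \<longleftrightarrow>
          sat ((shift e t d)(x := y + int_scale (t' x) d')) \<phi>"
        using same by (intro sat_cong) auto
      finally show ?thesis by auto
    qed
    show "\<exists>Q. \<forall>(e :: nat \<Rightarrow> 'a) t d.
        good_shift ?F ?M Q T e t d \<longrightarrow> (sat e (Ex x \<phi>) \<longleftrightarrow> sat (shift e t d) (Ex x \<phi>))"
    \<comment> \<open>The two arguments of \<open>max\<close> serve the two directions; since
      \<open>T\<close> may be negative, the second need not exceed the first.\<close>
    proof (intro exI[of _ "max Q (Q + int (card ?F) * (int ?M * T))"] allI impI)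
      fix e :: "nat \<Rightarrow> 'a" and t d
      assume gs: "good_shift ?F ?M (max Q (Q + int (card ?F) * (int ?M * T))) T e t d"
      have gs1: "good_shift ?F ?M Q T e t d"
        by (rule good_shift_mono[OF gs]) (auto simp: finite_fvars)
      have "good_shift ?F ?M (Q + int (card ?F) * (int ?M * T)) T e t d"
        by (rule good_shift_mono[OF gs]) (auto simp: finite_fvars)
      then have gs2: "good_shift ?F ?M Q T (shift e t d) (\<lambda>i. - t i) d"
        by (rule good_shift_sym)
      have "shift (shift e t d) (\<lambda>i. - t i) d = e" by auto
      then show "sat e (Ex x \<phi>) \<longleftrightarrow> sat (shift e t d) (Ex x \<phi>)"
        using forth[OF gs1] forth[OF gs2] by metis
    qed
  qed
qed

section \<open>Linear relations for definable elements\<close>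

definition least_pos :: "'a::linordered_ab_group_add \<Rightarrow> bool" where
  "least_pos u \<longleftrightarrow> 0 < u \<and> (\<forall>v. 0 < v \<longrightarrow> u \<le> v)"

text \<open>The value \<open>0\<close> in the dense case lets both cases be treated alike.\<close>

definition dunit :: "'a::linordered_ab_group_add" where
  "dunit = (if \<exists>u :: 'a. least_pos u then THE u. least_pos u else 0)"

lemma dunit_eq:
  assumes "least_pos u"
  shows "dunit = u"
proof -
  have "(THE u. least_pos u) = u"
    using assms by (intro the_equality) (simp_all add: least_pos_def order.eq_iff)
  then show ?thesis using assms unfolding dunit_def by (metis (full_types))
qed

section \<open>Small elements in discrete and in dense groups\<close>

text \<open>A positive element stays nonnegative after subtracting \<open>u\<close>, so induction on
  \<open>N\<close> exhausts the interval by multiples of \<open>u\<close>.\<close>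

lemma near_least_pos:
  assumes u: "least_pos u" and z: "near (int_scale (int N) u) z"
  shows "\<exists>k. \<bar>k\<bar> \<le> int N \<and> z = int_scale k u"
proof -
  have pos: "\<exists>k. 0 \<le> k \<and> k \<le> int N \<and> z = int_scale k u" if "0 \<le> z" "z \<le> int_scale (int N) u" for z
    using that
  proof (induction N arbitrary: z)
    case 0
    then show ?case by auto
  next
    case (Suc N)
    show ?case
    proof (cases "z = 0")
      case True
      then show ?thesis by (intro exI[of _ 0]) auto
    next
      case False
      then have "u \<le> z" using u Suc.prems by (auto simp: least_pos_def)
      then have "0 \<le> z - u" "z - u \<le> int_scale (int N) u"
        using Suc.prems by (auto simp: Z.scale_left_distrib algebra_simps)
      then obtain k where "0 \<le> k" "k \<le> int N" "z - u = int_scale k u" using Suc.IH by blast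
      then show ?thesis
        by (intro exI[of _ "k + 1"]) (auto simp: Z.scale_left_distrib algebra_simps)
    qed
  qed
  show ?thesis
  proof (cases "0 \<le> z")
    case True
    then show ?thesis using pos[of z] z by (force simp: near_def)
  next
    case False
    then have "0 \<le> - z" "- z \<le> int_scale (int N) u" using z by (auto simp: near_def minus_le_iff)
    then obtain k where "0 \<le> k" "k \<le> int N" "- z = int_scale k u" using pos by blast
    moreover from this have "z = - int_scale k u" by (metis minus_minus)
    ultimately show ?thesis by (intro exI[of _ "- k"]) auto
  qed
qed

text \<open>Some \<open>y\<close> lies strictly between 0 and \<open>x\<close>. Fit \<open>N\<close>
  copies below \<open>y\<close> and one more into \<open>x - y\<close>; the smaller of the two
  choices does both.\<close>

lemma dense_small_multiple:
  fixes x :: "'a::linordered_ab_group_add"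
  assumes dense: "\<nexists>u :: 'a. least_pos u" and "0 < x"
  shows "\<exists>\<delta>>0. int_scale (int N) \<delta> < x"
  using assms(2)
proof (induction N arbitrary: x)
  case 0
  then show ?case by auto
next
  case (Suc N)
  obtain y where y: "0 < y" "y < x" using dense Suc.prems by (auto simp: least_pos_def not_le)
  obtain \<delta> where \<delta>: "0 < \<delta>" "int_scale (int N) \<delta> < y" using Suc.IH[OF y(1)] by blast
  let ?m = "min \<delta> (x - y)"
  have "0 < ?m" using \<delta> y by simp
  moreover have "int_scale (int (Suc N)) ?m < x"
  proof (cases "N = 0")
    case True
    then show ?thesis using y by (auto simp: min_less_iff_disj)
  next
    case False
    have "int_scale (int N) ?m \<le> int_scale (int N) \<delta>"
      using False by (subst int_scale_le_cancel) auto
    then have "int_scale (int N) ?m < y" using \<delta> by simp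
    then have "int_scale (int N) ?m + ?m < y + (x - y)" by (rule add_less_le_mono) simp
    then show ?thesis by (simp add: Z.scale_left_distrib add.commute)
  qed
  ultimately show ?case by blast
qed

text \<open>The smaller of two values of \<open>\<delta>\<close> serves both purposes;
  \<open>max x (- x)\<close> acts as the absolute value of \<open>x\<close>. The positive element
  supplies \<open>\<delta>\<close> for empty \<open>X\<close>.\<close>

lemma dense_separate:
  fixes X :: "'a::linordered_ab_group_add set"
  assumes dense: "\<nexists>u :: 'a. least_pos u" and ex: "\<exists>a :: 'a. 0 < a"
    and "finite X" "0 \<notin> X"
  shows "\<exists>\<delta>>0. \<forall>x\<in>X. \<not> near (int_scale (int N) \<delta>) x"
  using assms(3,4)
proof (induction X)
  case empty
  then show ?case using ex by auto
next
  case (insert x X)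
  then obtain \<delta> where \<delta>: "0 < \<delta>" "\<forall>x\<in>X. \<not> near (int_scale (int N) \<delta>) x" by auto
  have "0 < max x (- x)" using insert.prems by (auto simp: max_def)
  then obtain \<delta>' where \<delta>': "0 < \<delta>'" "int_scale (int N) \<delta>' < max x (- x)"
    using dense_small_multiple[OF dense] by blast
  then have nx: "\<not> near (int_scale (int N) \<delta>') x"
    by (auto simp: near_def max_def minus_le_iff split: if_splits)
  let ?m = "min \<delta> \<delta>'"
  have "int_scale (int N) ?m \<le> int_scale (int N) \<delta>" "int_scale (int N) ?m \<le> int_scale (int N) \<delta>'"
    by (cases "N = 0"; simp add: int_scale_le_cancel)+
  then have "\<forall>z\<in>insert x X. \<not> near (int_scale (int N) ?m) z"
    using near_mono \<delta>(2) nx by blast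
  then show ?case using \<delta>(1) \<delta>'(1) by (intro exI[of _ ?m]) auto
qed

lemma finite_bounded_functions:
  assumes "finite F"
  shows "finite {r :: nat \<Rightarrow> int. (\<forall>i\<in>F. \<bar>r i\<bar> \<le> K) \<and> (\<forall>i. i \<notin> F \<longrightarrow> r i = 0)}"
proof -
  have "finite {r :: nat \<Rightarrow> int. \<forall>i. (i \<in> F \<longrightarrow> r i \<in> {- K..K}) \<and> (i \<notin> F \<longrightarrow> r i = 0)}"
    using assms by (intro finite_set_of_finite_funs) auto
  then show ?thesis by (rule rev_finite_subset) (auto simp: abs_le_iff)
qed

text \<open>Otherwise moving only the value of \<open>x\<close> would be a good shift, for a suitable \<open>d\<close>, and give a second
  solution of \<open>\<phi>\<close>.\<close>

lemma definable_elt_relation: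
  "\<exists>K. \<forall>e :: nat \<Rightarrow> 'a::linordered_ab_group_add.
     sat e \<phi> \<and> (\<forall>a. sat (e(x := a)) \<phi> \<longrightarrow> a = e x) \<longrightarrow>
     (\<exists>r k. (\<forall>i. \<bar>r i\<bar> \<le> K) \<and> (\<forall>i. i \<notin> insert x (fvars \<phi>) \<longrightarrow> r i = 0) \<and> \<bar>k\<bar> \<le> K \<and> r x \<noteq> 0 \<and>
        (\<Sum>i\<in>insert x (fvars \<phi>). int_scale (r i) (e i)) = int_scale k dunit)"
proof -
  let ?F = "insert x (fvars \<phi>)"
  have finF: "finite ?F" by (simp add: finite_fvars)
  obtain M where "\<forall>T. \<exists>Q. \<forall>(e :: nat \<Rightarrow> 'a) t d.
      good_shift (fvars \<phi>) M Q T e t d \<longrightarrow> (sat e \<phi> \<longleftrightarrow> sat (shift e t d) \<phi>)"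
    using sat_shift_invariant[of \<phi>] by blast
  \<comment> \<open>The bound 1 on \<open>t\<close> suffices because the shift used below moves only
    \<open>x\<close>, by one copy of \<open>d\<close>.\<close>
  then obtain Q where Q: "\<forall>(e :: nat \<Rightarrow> 'a) t d.
      good_shift (fvars \<phi>) M Q 1 e t d \<longrightarrow> (sat e \<phi> \<longleftrightarrow> sat (shift e t d) \<phi>)"
    by blast
  have inv: "sat e \<phi> \<longleftrightarrow> sat (shift e t d) \<phi>" if "good_shift ?F M Q 1 e t d"
    for e :: "nat \<Rightarrow> 'a" and t d
    by (intro Q[rule_format] good_shift_mono[OF that finF]) auto
  \<comment> \<open>With \<open>d\<close> equal to \<open>fact M\<close> copies of
    \<open>\<delta>\<close>, \<open>Q\<close> copies of \<open>d\<close> are at most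
    \<open>N\<close> copies of \<open>\<delta>\<close>.\<close>
  define N where "N = nat \<bar>Q * fact M\<bar>"
  define R where "R = {r :: nat \<Rightarrow> int. (\<forall>i\<in>?F. \<bar>r i\<bar> \<le> int M) \<and> (\<forall>i. i \<notin> ?F \<longrightarrow> r i = 0)}"
  have finR: "finite R" unfolding R_def by (rule finite_bounded_functions[OF finF])
  \<comment> \<open>The summand 1 in the bound admits the coefficient 1 used for the trivial
    group.\<close>
  have "\<exists>r k. (\<forall>i. \<bar>r i\<bar> \<le> int (M + N + 1)) \<and> (\<forall>i. i \<notin> ?F \<longrightarrow> r i = 0) \<and> \<bar>k\<bar> \<le> int (M + N + 1) \<and>
      r x \<noteq> 0 \<and> (\<Sum>i\<in>?F. int_scale (r i) (e i)) = int_scale k dunit"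
    if e: "sat e \<phi>" "\<forall>a. sat (e(x := a)) \<phi> \<longrightarrow> a = e x" for e :: "nat \<Rightarrow> 'a"
  proof -
    let ?v = "\<lambda>r. \<Sum>i\<in>?F. int_scale (r i) (e i)"
    define t where "t i = (if i = x then 1 else 0 :: int)" for i
    \<comment> \<open>Adding \<open>d\<close> to the value of \<open>x\<close> destroys the unique
      solution, so this shift is not good. Its other clauses hold, so some combination violates the
      gap; its displacement coefficient is \<open>r x\<close>.\<close>
    have rel: "\<exists>r\<in>R. r x \<noteq> 0 \<and> near (int_scale (int N) \<delta>) (?v r)" if \<delta>: "0 < \<delta>" for \<delta>
    proof -
      define d where "d = int_scale (fact M) \<delta>"
      have d: "0 < d" unfolding d_def using \<delta> by (intro int_scale_pos) auto
      have "shift e t d = e(x := e x + d)" by (simp add: t_def fun_eq_iff)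
      moreover have "\<not> sat (e(x := e x + d)) \<phi>" using e(2) d by auto
      ultimately have "\<not> sat (shift e t d) \<phi>" by simp
      then have "\<not> good_shift ?F M Q 1 e t d" using inv[of e t d] e(1) by fast
      moreover have "\<exists>\<delta>'. d = int_scale (fact M) \<delta>'" using d_def by blast
      moreover have "\<forall>i\<in>?F. \<bar>t i\<bar> \<le> 1" by (simp add: t_def)
      ultimately obtain r where r: "\<forall>i\<in>?F. \<bar>r i\<bar> \<le> int M" "(\<Sum>i\<in>?F. r i * t i) \<noteq> 0"
        "near (int_scale Q d) (?v r)"
        unfolding good_shift_def using d by blast
      have "(\<Sum>i\<in>?F. r i * t i) = (\<Sum>i\<in>?F. if i = x then r i else 0)"
        by (rule sum.cong) (auto simp: t_def)
      also have "\<dots> = r x" using finF by simp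
      finally have rx: "r x \<noteq> 0" using r(2) by simp
      define r' where "r' i = (if i \<in> ?F then r i else 0)" for i
      have "r' \<in> R" "r' x \<noteq> 0" using r(1) rx by (auto simp: R_def r'_def)
      moreover have "?v r' = ?v r" by (rule sum.cong) (auto simp: r'_def)
      moreover have "near (int_scale (int N) \<delta>) (?v r)"
      proof (rule near_mono[OF r(3)])
        show "int_scale Q d \<le> int_scale (int N) \<delta>"
          unfolding d_def int_scale_mult using \<delta> by (intro int_scale_mono) (auto simp: N_def)
      qed
      ultimately show ?thesis by (intro bexI[of _ r']) simp_all
    qed
    have sol: ?thesis if "r \<in> R" "r x \<noteq> 0" "\<bar>k\<bar> \<le> int N" "?v r = int_scale k dunit" for r k
    proof -
      have "\<bar>r i\<bar> \<le> int (M + N + 1)" for i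
      proof (cases "i \<in> ?F")
        case True
        then have "\<bar>r i\<bar> \<le> int M" using that(1) unfolding R_def by blast
        then show ?thesis by simp
      next
        case False
        then have "r i = 0" using that(1) unfolding R_def by blast
        then show ?thesis by simp
      qed
      then show ?thesis using that by (intro exI[of _ r] exI[of _ k]) (simp add: R_def)
    qed
    \<comment> \<open>Three cases: a least positive element is itself taken as
      \<open>\<delta>\<close>; in a nontrivial group without one, \<open>\<delta>\<close> is so
      small that the combination must vanish; in the trivial group every relation holds.\<close>
    show ?thesis
    proof (cases "\<exists>u :: 'a. least_pos u")
      case True
      then obtain u :: 'a where u: "least_pos u" by blast
      then have "0 < u" by (simp add: least_pos_def)
      then obtain r where r: "r \<in> R" "r x \<noteq> 0" "near (int_scale (int N) u) (?v r)"
        using rel by blast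
      then obtain k where "\<bar>k\<bar> \<le> int N" "?v r = int_scale k u"
        using near_least_pos[OF u] by blast
      then show ?thesis using sol r dunit_eq[OF u] by simp
    next
      case dense: False
      show ?thesis
      proof (cases "\<exists>a :: 'a. 0 < a")
        case True
        have "finite (?v ` R - {0})" "0 \<notin> ?v ` R - {0}" using finR by auto
        then obtain \<delta> where \<delta>: "0 < \<delta>" "\<forall>z \<in> ?v ` R - {0}. \<not> near (int_scale (int N) \<delta>) z"
          using dense_separate[OF dense True] by blast
        then obtain r where r: "r \<in> R" "r x \<noteq> 0" "near (int_scale (int N) \<delta>) (?v r)"
          using rel by blast
        then have "?v r = 0" using \<delta>(2) by blast
        then show ?thesis using sol[OF r(1,2), of 0] by simp
      next
        case False
        then have zero: "a = 0" for a :: 'a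
          using linorder_neqE[of a 0] neg_0_less_iff_less[of a] by blast
        have "?v t = int_scale 0 dunit" by (simp only: zero[of "?v t"] int_scale_0)
        moreover have "\<forall>i. \<bar>t i\<bar> \<le> int (M + N + 1)" "\<forall>i. i \<notin> ?F \<longrightarrow> t i = 0" "t x \<noteq> 0"
          "\<bar>0 :: int\<bar> \<le> int (M + N + 1)" by (simp_all add: t_def)
        ultimately show ?thesis by blast
      qed
    qed
  qed
  then show ?thesis by (intro exI[of _ "int (M + N + 1)"]) simp
qed

section \<open>Definable sets and partitions\<close>

fun rename_term :: "(nat \<Rightarrow> nat) \<Rightarrow> oag_term \<Rightarrow> oag_term" where
  "rename_term \<pi> (Var i) = Var (\<pi> i)"
| "rename_term \<pi> Zero = Zero"
| "rename_term \<pi> (Plus u v) = Plus (rename_term \<pi> u) (rename_term \<pi> v)"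

fun rename :: "(nat \<Rightarrow> nat) \<Rightarrow> oag_fm \<Rightarrow> oag_fm" where
  "rename \<pi> (Eq u v) = Eq (rename_term \<pi> u) (rename_term \<pi> v)"
| "rename \<pi> (Less u v) = Less (rename_term \<pi> u) (rename_term \<pi> v)"
| "rename \<pi> (Neg \<phi>) = Neg (rename \<pi> \<phi>)"
| "rename \<pi> (Conj \<phi> \<psi>) = Conj (rename \<pi> \<phi>) (rename \<pi> \<psi>)"
| "rename \<pi> (Ex x \<phi>) = Ex (\<pi> x) (rename \<pi> \<phi>)"

lemma tval_rename_term: "tval e (rename_term \<pi> u) = tval (\<lambda>i. e (\<pi> i)) u"
  by (induction u) auto

lemma tvars_rename_term: "tvars (rename_term \<pi> u) = \<pi> ` tvars u"
  by (induction u) auto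

text \<open>Bound variables are renamed too, so injectivity is what prevents capture.\<close>

lemma sat_rename:
  assumes "inj \<pi>"
  shows "sat e (rename \<pi> \<phi>) \<longleftrightarrow> sat (\<lambda>i. e (\<pi> i)) \<phi>"
proof (induction \<phi> arbitrary: e)
  case (Ex x \<phi>)
  have "(\<lambda>i. (e(\<pi> x := a)) (\<pi> i)) = (\<lambda>i. e (\<pi> i))(x := a)" for a
    using assms by (auto simp: inj_eq)
  then show ?case by (simp add: Ex.IH)
qed (auto simp: tval_rename_term)

lemma fvars_rename: "inj \<pi> \<Longrightarrow> fvars (rename \<pi> \<phi>) = \<pi> ` fvars \<phi>"
  by (induction \<phi>) (auto simp: tvars_rename_term inj_eq)

section \<open>Formulas for linear relations and for the least positive element\<close>

fun mult_term :: "nat \<Rightarrow> nat \<Rightarrow> oag_term" where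
  "mult_term 0 i = Zero"
| "mult_term (Suc k) i = Plus (Var i) (mult_term k i)"

fun comb_term :: "(nat \<Rightarrow> nat) \<Rightarrow> nat \<Rightarrow> oag_term" where
  "comb_term c 0 = Zero"
| "comb_term c (Suc m) = Plus (comb_term c m) (mult_term (c m) m)"

text \<open>The language has no subtraction, so terms with negative coefficients move to the other
  side of the equation.\<close>

definition lin_fm :: "(nat \<Rightarrow> int) \<Rightarrow> nat \<Rightarrow> oag_fm" where
  "lin_fm r m = Eq (comb_term (\<lambda>i. nat (r i)) m) (comb_term (\<lambda>i. nat (- r i)) m)"

lemma tval_mult_term: "tval e (mult_term k i) = int_scale (int k) (e i)"
  by (induction k) (auto simp: int_scale_add int_scale_1)

lemma tval_comb_term: "tval e (comb_term c m) = (\<Sum>i<m. int_scale (int (c i)) (e i))"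
  by (induction m) (auto simp: tval_mult_term)

lemma tvars_mult_term: "tvars (mult_term k i) \<subseteq> {i}"
  by (induction k) auto

lemma tvars_comb_term: "tvars (comb_term c m) \<subseteq> {..<m}"
proof (induction m)
  case (Suc m)
  then show ?case using tvars_mult_term[of "c m" m] by force
qed simp

lemma sat_lin_fm: "sat e (lin_fm r m) \<longleftrightarrow> (\<Sum>i<m. int_scale (r i) (e i)) = 0"
proof -
  have "int_scale (r i) (e i) = int_scale (int (nat (r i))) (e i) - int_scale (int (nat (- r i))) (e i)"
    for i by (cases "0 \<le> r i") auto
  then show ?thesis by (simp add: lin_fm_def tval_comb_term sum_subtractf)
qed

lemma fvars_lin_fm: "fvars (lin_fm r m) \<subseteq> {..<m}"
  using tvars_comb_term by (auto simp: lin_fm_def)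

text \<open>The formula may depend on the group: it describes the least positive element if there is
  one, and 0 otherwise. Either way \<open>dunit\<close> is definable without parameters.\<close>

lemma dunit_formula:
  "\<exists>\<chi>. fvars \<chi> = {x} \<and> (\<forall>e :: nat \<Rightarrow> 'a::linordered_ab_group_add. sat e \<chi> \<longleftrightarrow> e x = dunit)"
proof (cases "\<exists>u :: 'a. least_pos u")
  case True
  then obtain u :: 'a where u: "least_pos u" by blast
  let ?\<chi> = "Conj (Less Zero (Var x))
    (Neg (Ex (Suc x) (Conj (Less Zero (Var (Suc x))) (Less (Var (Suc x)) (Var x)))))"
  have "sat e ?\<chi> \<longleftrightarrow> e x = dunit" for e :: "nat \<Rightarrow> 'a"
  proof -
    have "sat e ?\<chi> \<longleftrightarrow> least_pos (e x)" by (auto simp: least_pos_def)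
    also have "\<dots> \<longleftrightarrow> e x = dunit" using u dunit_eq by metis
    finally show ?thesis .
  qed
  then show ?thesis by (intro exI[of _ ?\<chi>]) auto
next
  case False
  then have "(dunit :: 'a) = 0" by (simp add: dunit_def)
  then show ?thesis by (intro exI[of _ "Eq (Var x) Zero"]) auto
qed

section \<open>Definability over a fixed parameter list\<close>

text \<open>Fixing the list \<open>bs\<close> lets Boolean combinations be formed directly, without
  merging parameter lists.\<close>

definition definable_by :: "'a::linordered_ab_group_add list \<Rightarrow> nat \<Rightarrow> 'a list set \<Rightarrow> bool" where
  "definable_by bs n X \<longleftrightarrow> (\<exists>\<phi>. fvars \<phi> \<subseteq> {..<n + length bs} \<and>
     X = {as \<in> tuples n. sat (\<lambda>i. (as @ bs) ! i) \<phi>})"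

lemma definable_by_imp_definable: "set bs \<subseteq> B \<Longrightarrow> definable_by bs n X \<Longrightarrow> definable B n X"
  unfolding definable_def definable_by_def by blast

lemma definable_by_Diff:
  assumes "definable_by bs n X" "definable_by bs n Y"
  shows "definable_by bs n (X - Y)"
proof -
  obtain \<phi> where \<phi>: "fvars \<phi> \<subseteq> {..<n + length bs}"
    "X = {as \<in> tuples n. sat (\<lambda>i. (as @ bs) ! i) \<phi>}"
    using assms(1) unfolding definable_by_def by blast
  obtain \<psi> where \<psi>: "fvars \<psi> \<subseteq> {..<n + length bs}"
    "Y = {as \<in> tuples n. sat (\<lambda>i. (as @ bs) ! i) \<psi>}"
    using assms(2) unfolding definable_by_def by blast
  show ?thesis
    unfolding definable_by_def using \<phi> \<psi> by (intro exI[of _ "Conj \<phi> (Neg \<psi>)"]) auto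
qed

text \<open>Each new set is cut out of the earlier pieces and then added as a piece; empty pieces
  are discarded because a partition excludes them.\<close>

lemma definable_partition_of_cover:
  assumes "finite \<A>" "\<forall>A\<in>\<A>. definable_by bs n A"
  shows "\<exists>P. finite P \<and> partition_on (\<Union>\<A>) P \<and> (\<forall>X\<in>P. definable_by bs n X \<and> (\<exists>A\<in>\<A>. X \<subseteq> A))"
  using assms
proof (induction \<A>)
  case empty
  show ?case by (intro exI[of _ "{}"]) (simp add: partition_on_def)
next
  case (insert A \<A>)
  then obtain P where P: "finite P" "partition_on (\<Union>\<A>) P"
    "\<forall>X\<in>P. definable_by bs n X \<and> (\<exists>A\<in>\<A>. X \<subseteq> A)" by auto
  define P' where "P' = insert A ((\<lambda>X. X - A) ` P) - {{}}"
  have "\<Union>P = \<Union>\<A>" "disjoint P" using P(2) by (auto simp: partition_on_def)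
  have "\<Union>P' = A \<union> (\<Union>P - A)" unfolding P'_def by auto
  then have "\<Union>P' = \<Union>(insert A \<A>)" using \<open>\<Union>P = \<Union>\<A>\<close> by auto
  moreover have "disjoint P'"
  proof (rule disjointI)
    fix X Y assume XY: "X \<in> P'" "Y \<in> P'" "X \<noteq> Y"
    have P': "X = A \<or> (\<exists>X'\<in>P. X = X' - A)" if "X \<in> P'" for X
      using that by (auto simp: P'_def)
    consider "X = A \<or> Y = A" | X' Y' where "X' \<in> P" "Y' \<in> P" "X = X' - A" "Y = Y' - A"
      using P'[OF XY(1)] P'[OF XY(2)] by blast
    then show "X \<inter> Y = {}"
    proof cases
      case 1
      then show ?thesis using P'[OF XY(1)] P'[OF XY(2)] XY(3) by auto
    next
      case 2
      then have "X' \<inter> Y' = {}" using disjointD[OF \<open>disjoint P\<close>, of X' Y'] XY(3) by auto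
      then show ?thesis using 2 by auto
    qed
  qed
  ultimately have "partition_on (\<Union>(insert A \<A>)) P'"
    by (simp add: partition_on_def P'_def)
  moreover have "finite P'" using P(1) by (simp add: P'_def)
  moreover have "definable_by bs n X \<and> (\<exists>A'\<in>insert A \<A>. X \<subseteq> A')" if X: "X \<in> P'" for X
  proof -
    consider "X = A" | Y where "Y \<in> P" "X = Y - A" using X by (auto simp: P'_def)
    then show ?thesis
    proof cases
      case 1
      then show ?thesis using insert.prems by auto
    next
      case 2
      then obtain A' where "definable_by bs n Y" "A' \<in> \<A>" "Y \<subseteq> A'" using P(3) by blast
      then show ?thesis using 2 insert.prems definable_by_Diff[of bs n Y A] by auto
    qed
  qed
  ultimately show ?case by blast
qed

lemma sum_lessThan_add:
  fixes g :: "nat \<Rightarrow> 'a::comm_monoid_add"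
  shows "(\<Sum>i<n + l. g i) = (\<Sum>i<n. g i) + (\<Sum>j<l. g (n + j))"
  by (induction l) (auto simp: add.assoc)

lemma combination_in_dcl:
  assumes "set bs \<subseteq> B"
  shows "(\<Sum>j<length bs. int_scale (q j) (bs ! j)) + int_scale k dunit \<in> dcl B"
proof -
  let ?l = "length bs"
  let ?b = "(\<Sum>j<?l. int_scale (q j) (bs ! j)) + int_scale k dunit"
  obtain \<chi> where \<chi>: "fvars \<chi> = {Suc ?l}" "\<And>e :: nat \<Rightarrow> 'a. sat e \<chi> \<longleftrightarrow> e (Suc ?l) = dunit"
    using dunit_formula by blast
  \<comment> \<open>Variable 0 holds the candidate value, the next \<open>?l\<close> variables the
    parameters, and \<open>Suc ?l\<close> holds \<open>dunit\<close>.\<close>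
  define r where "r i = (if i = 0 then - 1 else if i = Suc ?l then k else q (i - 1))" for i
  let ?\<psi> = "Ex (Suc ?l) (Conj \<chi> (lin_fm r (Suc (Suc ?l))))"
  have sat_\<psi>: "sat (\<lambda>i. ([z] @ bs) ! i) ?\<psi> \<longleftrightarrow> z = ?b" for z
  proof -
    let ?e = "(\<lambda>i. ([z] @ bs) ! i)(Suc ?l := dunit)"
    have "(\<Sum>i<Suc (Suc ?l). int_scale (r i) (?e i)) =
        (\<Sum>i<Suc ?l. int_scale (r i) (?e i)) + int_scale k dunit"
      by (simp add: r_def)
    also have "(\<Sum>i<Suc ?l. int_scale (r i) (?e i)) =
        - z + (\<Sum>j<?l. int_scale (r (Suc j)) (?e (Suc j)))"
      by (subst sum.lessThan_Suc_shift) (simp add: r_def int_scale_1)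
    also have "(\<Sum>j<?l. int_scale (r (Suc j)) (?e (Suc j))) = (\<Sum>j<?l. int_scale (q j) (bs ! j))"
      by (rule sum.cong) (auto simp: r_def)
    finally have "(\<Sum>i<Suc (Suc ?l). int_scale (r i) (?e i)) = ?b - z" by simp
    then have "sat ?e (lin_fm r (Suc (Suc ?l))) \<longleftrightarrow> z = ?b"
      unfolding sat_lin_fm by (metis right_minus_eq)
    then show ?thesis using \<chi>(2) by simp
  qed
  have "fvars ?\<psi> \<subseteq> {..<1 + ?l}"
    using fvars_lin_fm[of r "Suc (Suc ?l)"] \<chi>(1) by (auto simp: less_Suc_eq)
  moreover have "{[?b]} = {as \<in> tuples 1. sat (\<lambda>i. (as @ bs) ! i) ?\<psi>}"
  proof (rule set_eqI)
    fix as
    show "as \<in> {[?b]} \<longleftrightarrow> as \<in> {as \<in> tuples 1. sat (\<lambda>i. (as @ bs) ! i) ?\<psi>}"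
    proof (cases "as \<in> tuples 1")
      case True
      then obtain z where "as = [z]" by (auto simp: tuples_def length_Suc_conv)
      then show ?thesis using sat_\<psi>[of z] True by (simp del: sat.simps)
    qed (auto simp: tuples_def)
  qed
  ultimately have "definable_by bs 1 {[?b]}"
    unfolding definable_by_def by blast
  then show ?thesis
    unfolding dcl_def using definable_by_imp_definable[OF assms] by blast
qed

section \<open>Covering the domain by finitely many linear relations\<close>

theorem corollary1p10:
  fixes B :: "'a::linordered_ab_group_add set" and n :: nat and f :: "'a list \<Rightarrow> 'a"
  assumes "n \<ge> 1" and "definable_fun B n f"
  shows "\<exists>P. finite P \<and> partition_on (tuples n) P \<and>
           (\<forall>A \<in> P. definable B n A \<and> linear_on B n f A)"
proof -
  obtain \<phi> bs where bs: "set bs \<subseteq> B" and \<phi>: "fvars \<phi> \<subseteq> {..<Suc n + length bs}"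
    "{as @ [f as] | as. as \<in> tuples n} = {as \<in> tuples (Suc n). sat (\<lambda>i. (as @ bs) ! i) \<phi>}"
    using assms(2) unfolding definable_fun_def definable_def by blast
  define l where "l = length bs"
  \<comment> \<open>The graph formula lists arguments, value, parameters. This permutation moves the
    value behind the parameters, so that arguments and parameters are adjacent as in
    \<open>definable_by\<close>.\<close>
  define \<pi> where "\<pi> i = (if i < n then i else if i = n then n + l else if i \<le> n + l then i - 1 else i)"
    for i
  define \<phi>' where "\<phi>' = rename \<pi> \<phi>"
  have inj: "inj \<pi>" by (rule injI) (auto simp: \<pi>_def split: if_splits)
  have fv: "fvars \<phi>' \<subseteq> {..<Suc (n + l)}"
    using \<phi>(1) by (auto simp: \<phi>'_def fvars_rename[OF inj] \<pi>_def l_def)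
  \<comment> \<open>Positions: arguments, parameters, the value \<open>y\<close> at
    \<open>n + l\<close>, and \<open>w\<close> from there on; the latter is meant for
    \<open>dunit\<close>.\<close>
  define E where "E as y w i = (if i < n + l then (as @ bs) ! i else if i = n + l then y else w)"
    for as and y w :: 'a and i
  have graph: "sat (E as y w) \<phi>' \<longleftrightarrow> y = f as" if as: "as \<in> tuples n" for as y w
  proof -
    have len: "length as = n" using as by (simp add: tuples_def)
    have "sat (E as y w) \<phi>' \<longleftrightarrow> sat (\<lambda>i. E as y w (\<pi> i)) \<phi>"
      unfolding \<phi>'_def by (rule sat_rename[OF inj])
    also have "\<dots> \<longleftrightarrow> sat (\<lambda>i. ((as @ [y]) @ bs) ! i) \<phi>"
    proof (rule sat_cong)
      fix i assume "i \<in> fvars \<phi>"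
      then have "i < Suc n + l" using \<phi>(1) by (auto simp: l_def)
      then consider "i < n" | "i = n" | j where "i = Suc (n + j)" "j < l"
        by (metis add_Suc less_natE nat_add_left_cancel_less not_less_iff_gr_or_eq less_imp_Suc_add)
      then show "E as y w (\<pi> i) = ((as @ [y]) @ bs) ! i"
        by cases (auto simp: E_def \<pi>_def nth_append len)
    qed
    also have "\<dots> \<longleftrightarrow> as @ [y] \<in> {as \<in> tuples (Suc n). sat (\<lambda>i. (as @ bs) ! i) \<phi>}"
      using len by (simp add: tuples_def)
    also have "\<dots> \<longleftrightarrow> y = f as" unfolding \<phi>(2)[symmetric] using as by auto
    finally show ?thesis .
  qed

  let ?m = "Suc (Suc (n + l))"
  define A where "A r = {as \<in> tuples n. (\<Sum>i<?m. int_scale (r i) (E as (f as) dunit i)) = 0}" for r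
  \<comment> \<open>\<open>K\<close> does not depend on the arguments, so finitely many coefficient
    vectors \<open>r\<close> suffice.\<close>
  obtain K where K: "\<And>e :: nat \<Rightarrow> 'a. sat e \<phi>' \<Longrightarrow> (\<And>a. sat (e(n + l := a)) \<phi>' \<Longrightarrow> a = e (n + l)) \<Longrightarrow>
     (\<exists>r k. (\<forall>i. \<bar>r i\<bar> \<le> K) \<and> (\<forall>i. i \<notin> insert (n + l) (fvars \<phi>') \<longrightarrow> r i = 0) \<and> \<bar>k\<bar> \<le> K \<and>
        r (n + l) \<noteq> 0 \<and>
        (\<Sum>i\<in>insert (n + l) (fvars \<phi>'). int_scale (r i) (e i)) = int_scale k dunit)"
    using definable_elt_relation[of \<phi>' "n + l", where 'a = 'a] by blast
  define R where "R = {r :: nat \<Rightarrow> int. (\<forall>i\<in>{..<?m}. \<bar>r i\<bar> \<le> K) \<and> (\<forall>i. i \<notin> {..<?m} \<longrightarrow> r i = 0)} \<inter>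
    {r. r (n + l) \<noteq> 0}"
  have "finite R" unfolding R_def using finite_bounded_functions[of "{..<?m}" K] by simp

  have cover: "\<exists>r\<in>R. as \<in> A r" if as: "as \<in> tuples n" for as
  proof -
    let ?e = "E as (f as) dunit"
    have "?e(n + l := a) = E as a dunit" for a by (auto simp: E_def)
    then have "sat (?e(n + l := a)) \<phi>' \<Longrightarrow> a = ?e (n + l)" for a
      using graph[OF as] by (simp add: E_def)
    then obtain r k where r: "\<forall>i. \<bar>r i\<bar> \<le> K" "\<forall>i. i \<notin> insert (n + l) (fvars \<phi>') \<longrightarrow> r i = 0"
      "\<bar>k\<bar> \<le> K" "r (n + l) \<noteq> 0"
      "(\<Sum>i\<in>insert (n + l) (fvars \<phi>'). int_scale (r i) (?e i)) = int_scale k dunit"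
      using K[of ?e] graph[OF as] by blast
    \<comment> \<open>The multiple of \<open>dunit\<close> moves to the left-hand side as one more
      coefficient.\<close>
    define r' where "r' = r(Suc (n + l) := - k)"
    have "(\<Sum>i<Suc (n + l). int_scale (r' i) (?e i)) = (\<Sum>i<Suc (n + l). int_scale (r i) (?e i))"
      by (rule sum.cong) (auto simp: r'_def)
    also have "\<dots> = (\<Sum>i\<in>insert (n + l) (fvars \<phi>'). int_scale (r i) (?e i))"
      using fv r(2) by (intro sum.mono_neutral_right) auto
    also note r(5)
    finally have "(\<Sum>i<?m. int_scale (r' i) (?e i)) = 0"
      by (simp add: r'_def E_def)
    moreover have "r' \<in> R"
      using r fv by (auto simp: R_def r'_def less_Suc_eq)
    ultimately show ?thesis using as by (auto simp: A_def)
  qed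

  have definable_A: "definable_by bs n (A r)" for r
  proof -
    obtain \<chi> where \<chi>: "fvars \<chi> = {Suc (n + l)}"
      "\<And>e :: nat \<Rightarrow> 'a. sat e \<chi> \<longleftrightarrow> e (Suc (n + l)) = dunit"
      using dunit_formula by blast
    let ?\<theta> = "Conj \<phi>' (Conj \<chi> (lin_fm r ?m))"
    \<comment> \<open>The value of \<open>f\<close> and \<open>dunit\<close> are quantified away;
      \<open>\<phi>'\<close> and \<open>\<chi>\<close> determine them uniquely.\<close>
    let ?\<psi> = "Ex (n + l) (Ex (Suc (n + l)) ?\<theta>)"
    have fv\<theta>: "fvars ?\<theta> \<subseteq> {..<?m}" using fv \<chi>(1) fvars_lin_fm[of r ?m] by auto
    have "sat (\<lambda>i. (as @ bs) ! i) ?\<psi> \<longleftrightarrow> as \<in> A r" if as: "as \<in> tuples n" for as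
    proof -
      have "sat ((\<lambda>i. (as @ bs) ! i)(n + l := y, Suc (n + l) := w)) ?\<theta> \<longleftrightarrow> sat (E as y w) ?\<theta>" for y w
        using fv\<theta> by (intro sat_cong) (auto simp: E_def)
      then have "sat (\<lambda>i. (as @ bs) ! i) ?\<psi> \<longleftrightarrow> (\<exists>y w. sat (E as y w) ?\<theta>)" by simp
      also have "\<dots> \<longleftrightarrow> sat (E as (f as) dunit) (lin_fm r ?m)"
        using graph[OF as] \<chi>(2) by (auto simp: E_def)
      also have "\<dots> \<longleftrightarrow> as \<in> A r" using as unfolding sat_lin_fm A_def by simp
      finally show ?thesis .
    qed
    then have "A r = {as \<in> tuples n. sat (\<lambda>i. (as @ bs) ! i) ?\<psi>}" by (auto simp: A_def)
    moreover have "fvars ?\<psi> \<subseteq> {..<n + length bs}" using fv\<theta> by (auto simp: l_def less_Suc_eq)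
    ultimately show ?thesis unfolding definable_by_def by blast
  qed

  have linear_A: "linear_on B n f X" if "r \<in> R" "X \<subseteq> A r" for r X
  proof -
    \<comment> \<open>Solving the relation for the value of \<open>f\<close>: its coefficient
      becomes the denominator, and the parameters and \<open>dunit\<close> are collected in
      \<open>b\<close>.\<close>
    define b where "b = (\<Sum>j<l. int_scale (- r (n + j)) (bs ! j)) + int_scale (- r (Suc (n + l))) dunit"
    have "b \<in> dcl B" unfolding b_def l_def by (rule combination_in_dcl[OF bs])
    moreover have "int_scale (r (n + l)) (f as) = (\<Sum>i<n. int_scale (- r i) (as ! i)) + b"
      if "as \<in> X" for as
    proof -
      have as: "length as = n" "(\<Sum>i<?m. int_scale (r i) (E as (f as) dunit i)) = 0"
        using that \<open>X \<subseteq> A r\<close> by (auto simp: A_def tuples_def)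
      have "(\<Sum>i<n. int_scale (r i) (E as (f as) dunit i)) = (\<Sum>i<n. int_scale (r i) (as ! i))"
        using as(1) by (intro sum.cong) (auto simp: E_def nth_append)
      moreover have "(\<Sum>j<l. int_scale (r (n + j)) (E as (f as) dunit (n + j))) =
          (\<Sum>j<l. int_scale (r (n + j)) (bs ! j))"
        using as(1) by (intro sum.cong) (auto simp: E_def nth_append)
      ultimately have "(\<Sum>i<n. int_scale (r i) (as ! i)) + (\<Sum>j<l. int_scale (r (n + j)) (bs ! j)) +
          int_scale (r (n + l)) (f as) + int_scale (r (Suc (n + l))) dunit = 0"
        using as(2) by (simp add: sum_lessThan_add) (simp add: E_def)
      then show ?thesis
        by (simp add: b_def sum_negf algebra_simps eq_neg_iff_add_eq_0)
    qed
    moreover have "r (n + l) \<noteq> 0" using \<open>r \<in> R\<close> by (simp add: R_def)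
    ultimately show ?thesis unfolding linear_on_def
      by (intro exI[of _ "\<lambda>i. - r i"] exI[of _ "r (n + l)"] exI[of _ b]) auto
  qed

  obtain P where "finite P" "partition_on (\<Union>(A ` R)) P"
    "\<forall>X\<in>P. definable_by bs n X \<and> (\<exists>Y\<in>A ` R. X \<subseteq> Y)"
    using definable_partition_of_cover[of "A ` R" bs n] \<open>finite R\<close> definable_A by auto
  moreover have "\<Union>(A ` R) = tuples n" using cover by (auto simp: A_def)
  ultimately show ?thesis
    using definable_by_imp_definable[OF bs] linear_A by (intro exI[of _ P]) auto
qed

end
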